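(* Let $G=\mathrm{GIRG}(n,\beta,w_0,d)$ be a standard GIRG with $\beta<3$. Then $\omega(G)=\Omega(n^{(3-\beta)/2})$ asymptotically almost surely.
   Context: Fix constants $\lambda>0$, $w_0>0$, $\beta>2$. A standard GIRG $\mathrm{GIRG}(n,\beta,w_0,d)$ has $n$ vertices; each vertex $v$ independently receives a weight $w_v$ with $\Pr[w_v\le x]=1-(x/w_0)^{1-\beta}$ for $x\ge w_0$, and independently a position $\mathbf{x}_v$ uniform on the torus $\mathbb{T}^d=[0,1)^d$. The distance is $d(\mathbf{x}_u,\mathbf{x}_v)=\max_{1\le i\le d}|x_{ui}-x_{vi}|_C$ with $|a-b|_C=\min\{|a-b|,1-|a-b|\}$. Distinct $u,v$ are adjacent iff $d(\mathbf{x}_u,\mathbf{x}_v)\le \frac12\big(\frac{\lambda w_uw_v}{n}\big)^{1/d}$. The dimension $d=d(n)$ may depend on $n$. $\omega(G)$ is the size of the largest clique; "asymptotically almost surely" means with probability $1-o(1)$ as $n\to\infty$. *)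

theory Defs
  imports "HOL-Probability.Probability" "HOL-Library.Ramsey"
begin

definition circ_dist :: "real \<Rightarrow> real \<Rightarrow> real" where
  "circ_dist a b = min \<bar>a - b\<bar> (1 - \<bar>a - b\<bar>)"

text \<open>Points of the \<open>d\<close>-dimensional torus are functions on the coordinate set \<open>{..<d}\<close>;
  the maximum is meaningful for \<open>d \<ge> 1\<close> only.\<close>

definition torus_dist :: "nat \<Rightarrow> (nat \<Rightarrow> real) \<Rightarrow> (nat \<Rightarrow> real) \<Rightarrow> real" where
  "torus_dist d x y = Max ((\<lambda>i. circ_dist (x i) (y i)) ` {..<d})"

definition torus_uniform :: "nat \<Rightarrow> (nat \<Rightarrow> real) measure" where
  "torus_uniform d = uniform_measure (\<Pi>\<^sub>M i\<in>{..<d}. lborel) (\<Pi>\<^sub>E i\<in>{..<d}. {0..<1})"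

text \<open>The random data of a GIRG with vertex set \<open>{..<n}\<close>: \<open>W v\<close> and \<open>X v\<close> are the weight and the
  position of \<open>v\<close>. All weights and positions are mutually independent: the pairs \<open>(W v, X v)\<close> are
  independent over \<open>v\<close>, and within each pair the weight is independent of the position. The latter is stated
  through the generated sigma-algebras, since \<open>indep_var\<close> requires both variables to have the same
  type. Measurability of \<open>W v\<close> and \<open>X v\<close> is part of the independence of the pairs.\<close>

locale girg = prob_space M
  for M :: "'a measure" and n :: nat and \<beta> w0 :: real and d :: nat
    and W :: "nat \<Rightarrow> 'a \<Rightarrow> real" and X :: "nat \<Rightarrow> 'a \<Rightarrow> nat \<Rightarrow> real" +
  assumes dim_pos: "1 \<le> d"
    and vertices_indep:
      "indep_vars (\<lambda>v. borel \<Otimes>\<^sub>M (\<Pi>\<^sub>M i\<in>{..<d}. lborel)) (\<lambda>v \<omega>. (W v \<omega>, X v \<omega>)) {..<n}"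
    and weight_position_indep:
      "\<And>v. v < n \<Longrightarrow> indep_set
         {W v -` A \<inter> space M | A. A \<in> sets borel}
         {X v -` B \<inter> space M | B. B \<in> sets (\<Pi>\<^sub>M i\<in>{..<d}. lborel)}"
    and weight_cdf:
      "\<And>v x. v < n \<Longrightarrow> w0 \<le> x \<Longrightarrow> prob {\<omega> \<in> space M. W v \<omega> \<le> x} = 1 - (x / w0) powr (1 - \<beta>)"
    and position_uniform:
      "\<And>v. v < n \<Longrightarrow> distr M (\<Pi>\<^sub>M i\<in>{..<d}. lborel) (X v) = torus_uniform d"

definition girg_edges ::
  "real \<Rightarrow> nat \<Rightarrow> nat \<Rightarrow> (nat \<Rightarrow> real) \<Rightarrow> (nat \<Rightarrow> nat \<Rightarrow> real) \<Rightarrow> nat set set" where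
  "girg_edges lam n d w x = {{u, v} | u v. u < n \<and> v < n \<and> u \<noteq> v \<and>
     torus_dist d (x u) (x v) \<le> 1 / 2 * (lam * w u * w v / real n) powr (1 / real d)}"

definition clique_number :: "'v set \<Rightarrow> 'v set set \<Rightarrow> nat" where
  "clique_number V E = Max (card ` {C. C \<subseteq> V \<and> clique C E})"

end

theory Submission
  imports Defs
begin

text \<open>Two points of the torus are at distance at most 1/2, so any two vertices whose weights have
  product at least \<open>n / \<lambda>\<close> are adjacent, whatever their positions and the dimension. Hence the
  vertices of weight above \<open>B \<surd>n\<close>, where \<open>B = max w\<^sub>0 (1 / \<surd>\<lambda>)\<close>, form a clique. Their number is
  binomial with mean \<open>(B / w\<^sub>0)\<^bsup>1 - \<beta>\<^esup> n\<^bsup>(3 - \<beta>)/2\<^esup>\<close>, which tends to infinity for \<open>\<beta> < 3\<close>,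
  and a Chernoff bound shows that it is at least a quarter of its mean asymptotically almost surely.\<close>

section \<open>Deterministic facts on cliques and torus distances\<close>

text \<open>Replaces the maximum by a quantifier over a finite set. Read from right to left it
  bounds the clique number by one exhibited clique; read from left to right it turns the event into
  a finite union.\<close>

lemma clique_number_ge_iff:
  assumes "finite V"
  shows "k \<le> real (clique_number V E) \<longleftrightarrow> (\<exists>C\<in>Pow V. k \<le> real (card C) \<and> clique C E)"
proof -
  let ?S = "card ` {C. C \<subseteq> V \<and> clique C E}"
  have fin: "finite ?S"
    using assms by simp
  \<comment> \<open>The empty clique keeps the set of sizes nonempty, so the maximum is
    attained.\<close>
  moreover have "clique {} E"
    by (simp add: clique_def)
  then have "?S \<noteq> {}"
    by blast
  ultimately have "Max ?S \<in> ?S"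
    by (rule Max_in)
  moreover have "real (card C) \<le> real (Max ?S)" if "C \<subseteq> V" "clique C E" for C
    using that fin by (intro of_nat_mono Max_ge) auto
  ultimately show ?thesis
    unfolding clique_number_def by (auto intro: order_trans)
qed

lemma circ_dist_commute: "circ_dist a b = circ_dist b a"
  by (simp add: circ_dist_def abs_minus_commute)

text \<open>The two arguments of \<open>min\<close> add up to 1.\<close>

lemma circ_dist_le_half: "circ_dist a b \<le> 1 / 2"
  by (simp add: circ_dist_def min_def)

lemma torus_dist_commute: "torus_dist d x y = torus_dist d y x"
  by (simp add: torus_dist_def circ_dist_commute)

lemma torus_dist_le_half: "1 \<le> d \<Longrightarrow> torus_dist d x y \<le> 1 / 2"
  unfolding torus_dist_def using circ_dist_le_half
  by (subst Max_le_iff) (auto simp: lessThan_empty_iff simp del: le_divide_eq_numeral1)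

text \<open>An unordered pair may be listed in either order, but distance and weight product are
  symmetric, so both orders give the same inequality.\<close>

lemma mem_girg_edges_iff:
  assumes "u < n" "v < n" "u \<noteq> v"
  shows "{u, v} \<in> girg_edges lam n d w x \<longleftrightarrow>
    torus_dist d (x u) (x v) \<le> 1 / 2 * (lam * w u * w v / real n) powr (1 / real d)"
proof
  assume "{u, v} \<in> girg_edges lam n d w x"
  then obtain u' v' where "{u, v} = {u', v'}"
    and *: "torus_dist d (x u') (x v') \<le> 1 / 2 * (lam * w u' * w v' / real n) powr (1 / real d)"
    unfolding girg_edges_def by blast
  then consider "u' = u" "v' = v" | "u' = v" "v' = u"
    by (auto simp: doubleton_eq_iff)
  then show "torus_dist d (x u) (x v) \<le> 1 / 2 * (lam * w u * w v / real n) powr (1 / real d)"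
    using * by cases
      (simp_all only: torus_dist_commute[of d "x v" "x u"] mult.assoc mult.commute[of "w v"])
next
  assume "torus_dist d (x u) (x v) \<le> 1 / 2 * (lam * w u * w v / real n) powr (1 / real d)"
  with assms show "{u, v} \<in> girg_edges lam n d w x"
    unfolding girg_edges_def by blast
qed

lemma clique_heavy_vertices:
  assumes "1 \<le> n" "1 \<le> d" "0 < lam" "0 \<le> t" "real n \<le> lam * t\<^sup>2"
  shows "clique {v\<in>{..<n}. t < w v} (girg_edges lam n d w x)"
proof -
  have "{u, v} \<in> girg_edges lam n d w x"
    if "u < n" "v < n" "u \<noteq> v" "t < w u" "t < w v" for u v
  proof -
    have "t * t \<le> w u * w v"
      using that assms by (intro mult_mono) auto
    then have "lam * (t * t) \<le> lam * (w u * w v)"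
      using assms by simp
    with assms(5) have "real n \<le> lam * w u * w v"
      by (simp only: power2_eq_square mult.assoc)
    then have "1 \<le> lam * w u * w v / real n"
      using assms by simp
    \<comment> \<open>The root of a number at least 1 is at least 1 for every \<open>d\<close>, so
      the connection radius reaches the diameter bound 1/2.\<close>
    then have "1 \<le> (lam * w u * w v / real n) powr (1 / real d)"
      by (intro ge_one_powr_ge_zero) auto
    then have "torus_dist d (x u) (x v) \<le> 1 / 2 * (lam * w u * w v / real n) powr (1 / real d)"
      using torus_dist_le_half[OF \<open>1 \<le> d\<close>, of "x u" "x v"] by linarith
    then show ?thesis
      using that by (simp add: mem_girg_edges_iff)
  qed
  then show ?thesis
    by (auto simp: clique_def)
qed

text \<open>Chernoff's bound with the parameter fixed to 1, where
  \<open>E[exp (- indicator)] = 1 - p (1 - 1/e) \<le> exp (- p/2)\<close>.\<close>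

lemma (in prob_space) prob_count_le_quarter_mean:
  fixes A :: "'i \<Rightarrow> 'b set"
  assumes fin: "finite I" and indep: "indep_vars N Y I"
    and A: "\<And>i. i \<in> I \<Longrightarrow> A i \<in> sets (N i)"
  defines "\<mu> \<equiv> \<Sum>i\<in>I. prob {\<omega> \<in> space M. Y i \<omega> \<in> A i}"
  shows "prob {\<omega> \<in> space M. real (card {i\<in>I. Y i \<omega> \<in> A i}) \<le> \<mu> / 4} \<le> exp (- \<mu> / 4)"
proof -
  define Z where "Z i \<omega> = exp (- indicator (A i) (Y i \<omega>) :: real)" for i \<omega>
  have Y[measurable]: "Y i \<in> measurable M (N i)" if "i \<in> I" for i
    using indep that by (auto simp: indep_vars_def)
  have Z_indep: "indep_vars (\<lambda>_. borel) Z I"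
    unfolding Z_def
  proof (rule indep_vars_compose2[OF indep])
    fix i assume "i \<in> I"
    then have [measurable]: "A i \<in> sets (N i)" by (rule A)
    show "(\<lambda>y. exp (- indicator (A i) y :: real)) \<in> borel_measurable (N i)"
      by measurable
  qed
  have Z_meas[measurable]: "Z i \<in> borel_measurable M" if "i \<in> I" for i
    using Z_indep that by (auto simp: indep_vars_def)
  have Z_int: "integrable M (Z i)" if "i \<in> I" for i
    using that by (intro integrable_const_bound[where B = 1]) (auto simp: Z_def indicator_def)
  have Z_exp: "expectation (Z i) \<le> exp (- prob {\<omega> \<in> space M. Y i \<omega> \<in> A i} / 2)"
    if i: "i \<in> I" for i
  proof -
    let ?E = "{\<omega> \<in> space M. Y i \<omega> \<in> A i}"
    have [measurable]: "A i \<in> sets (N i)" using i by (rule A)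
    have E[measurable]: "?E \<in> events" using i by measurable
    have int: "integrable M (indicat_real ?E)"
      by (rule integrable_const_bound[where B = 1]) (auto simp: indicator_def)
    \<comment> \<open>On the values 0 and 1 the map x to exp(-x) agrees with the affine map x to 1 -
      (1 - 1/e) x.\<close>
    have "expectation (Z i) = expectation (\<lambda>\<omega>. 1 - (1 - exp (- 1)) * indicator ?E \<omega>)"
      by (intro Bochner_Integration.integral_cong) (auto simp: Z_def indicator_def)
    also have "\<dots> = 1 - (1 - exp (- 1)) * prob ?E"
      using int by (subst Bochner_Integration.integral_diff) (auto simp: prob_space)
    also have "\<dots> \<le> 1 - prob ?E / 2"
    proof -
      have "exp (- 1 :: real) \<le> 1 / 2"
        using exp_ge_add_one_self[of "1 :: real"] by (simp add: exp_minus field_simps)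
      then have "1 / 2 * prob ?E \<le> (1 - exp (- 1)) * prob ?E"
        by (intro mult_right_mono) auto
      then show ?thesis by simp
    qed
    also have "\<dots> \<le> exp (- prob ?E / 2)"
      using exp_ge_add_one_self[of "- prob ?E / 2"] by simp
    finally show ?thesis .
  qed
  have prod_eq: "(\<Prod>i\<in>I. Z i \<omega>) = exp (- real (card {i\<in>I. Y i \<omega> \<in> A i}))" for \<omega>
  proof -
    have "(\<Sum>i\<in>I. indicator (A i) (Y i \<omega>) :: real) = real (card {i\<in>I. Y i \<omega> \<in> A i})"
      using fin by (simp add: indicator_def sum.If_cases Int_def)
    then show ?thesis
      using fin by (simp add: Z_def exp_sum[symmetric] sum_negf)
  qed
  have prod_int: "integrable M (\<lambda>\<omega>. \<Prod>i\<in>I. Z i \<omega>)"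
    using fin Z_indep Z_int by (rule indep_vars_integrable)
  \<comment> \<open>A small count means a large value of exp(-count), so Markov's inequality applies
    to the product of the \<open>Z i\<close>.\<close>
  have "prob {\<omega> \<in> space M. real (card {i\<in>I. Y i \<omega> \<in> A i}) \<le> \<mu> / 4}
      = prob {\<omega> \<in> space M. exp (- \<mu> / 4) \<le> (\<Prod>i\<in>I. Z i \<omega>)}"
    unfolding prod_eq by simp
  also have "\<dots> \<le> expectation (\<lambda>\<omega>. \<Prod>i\<in>I. Z i \<omega>) / exp (- \<mu> / 4)"
    using prod_int by (intro integral_Markov_inequality_measure[where A = "space M"])
      (auto simp: prod_eq)
  also have "expectation (\<lambda>\<omega>. \<Prod>i\<in>I. Z i \<omega>) = (\<Prod>i\<in>I. expectation (Z i))"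
    using fin Z_indep Z_int by (rule indep_vars_lebesgue_integral)
  also have "\<dots> \<le> (\<Prod>i\<in>I. exp (- prob {\<omega> \<in> space M. Y i \<omega> \<in> A i} / 2))"
    using Z_exp by (intro prod_mono) (auto simp: Z_def intro!: Bochner_Integration.integral_nonneg)
  also have "\<dots> = exp (- \<mu> / 2)"
    using fin by (simp add: \<mu>_def exp_sum[symmetric] sum_negf sum_divide_distrib)
  \<comment> \<open>The threshold \<mu>/4 costs only half of the exponent \<mu>/2.\<close>
  also have "exp (- \<mu> / 2) / exp (- \<mu> / 4) = exp (- \<mu> / 4)"
    by (simp add: exp_diff[symmetric])
  finally show ?thesis
    by (simp add: divide_right_mono)
qed

section \<open>Events of a single GIRG\<close>

context girg
begin

lemma weight_measurable: "v < n \<Longrightarrow> W v \<in> borel_measurable M"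
  and position_measurable: "v < n \<Longrightarrow> X v \<in> measurable M (\<Pi>\<^sub>M i\<in>{..<d}. lborel)"
proof -
  assume "v < n"
  then have *: "(\<lambda>\<omega>. (W v \<omega>, X v \<omega>)) \<in> measurable M (borel \<Otimes>\<^sub>M (\<Pi>\<^sub>M i\<in>{..<d}. lborel))"
    using vertices_indep by (auto simp: indep_vars_def)
  from measurable_fst'[OF *] show "W v \<in> borel_measurable M" by simp
  from measurable_snd'[OF *] show "X v \<in> measurable M (\<Pi>\<^sub>M i\<in>{..<d}. lborel)" by simp
qed

text \<open>A finite union, over vertex sets, of finite intersections of edge events. It allows
  passing to the complement when the failure probability is bounded.\<close>

lemma clique_number_measurable:
  "{\<omega> \<in> space M. k \<le> real (clique_number {..<n}
      (girg_edges lam n d (\<lambda>v. W v \<omega>) (\<lambda>v. X v \<omega>)))} \<in> events"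
proof -
  have edge: "Measurable.pred M
      (\<lambda>\<omega>. {u, v} \<in> girg_edges lam n d (\<lambda>v. W v \<omega>) (\<lambda>v. X v \<omega>))"
    if uv: "u < n" "v < n" "u \<noteq> v" for u v
  proof -
    have coord: "(\<lambda>\<omega>. X v \<omega> i) \<in> borel_measurable M" if "v < n" "i < d" for v i
      using measurable_compose[OF position_measurable[OF that(1)] measurable_component_singleton, of i]
        that by simp
    have "(\<lambda>\<omega>. circ_dist (X u \<omega> i) (X v \<omega> i)) \<in> borel_measurable M" if "i < d" for i
      using coord[OF uv(1) that] coord[OF uv(2) that] unfolding circ_dist_def by measurable
    then have "(\<lambda>\<omega>. torus_dist d (X u \<omega>) (X v \<omega>)) \<in> borel_measurable M"
      unfolding torus_dist_def by (intro borel_measurable_Max) auto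
    then show ?thesis
      using weight_measurable[OF uv(1)] weight_measurable[OF uv(2)]
      unfolding mem_girg_edges_iff[OF uv] by measurable
  qed
  have "Measurable.pred M (\<lambda>\<omega>. clique C (girg_edges lam n d (\<lambda>v. W v \<omega>) (\<lambda>v. X v \<omega>)))"
    if "C \<subseteq> {..<n}" for C
  proof -
    have fin: "finite C" using that by (rule finite_subset) simp
    have "Measurable.pred M (\<lambda>\<omega>. u \<noteq> v \<longrightarrow>
        {u, v} \<in> girg_edges lam n d (\<lambda>v. W v \<omega>) (\<lambda>v. X v \<omega>))" if "u \<in> C" "v \<in> C" for u v
      using edge[of u v] that \<open>C \<subseteq> {..<n}\<close> by (cases "u = v") auto
    then show ?thesis
      unfolding clique_def by (intro pred_intros_finite(3) fin)
  qed
  then have "Measurable.pred M (\<lambda>\<omega>. \<exists>C\<in>Pow {..<n}. k \<le> real (card C) \<and>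
      clique C (girg_edges lam n d (\<lambda>v. W v \<omega>) (\<lambda>v. X v \<omega>)))"
    by (intro pred_intros_finite(4) pred_intros_logic(3)) simp_all
  then show ?thesis
    unfolding pred_def clique_number_ge_iff[OF finite_lessThan] .
qed

lemma prob_weight_gt:
  assumes "v < n" "w0 \<le> t"
  shows "prob {\<omega> \<in> space M. t < W v \<omega>} = (t / w0) powr (1 - \<beta>)"
proof -
  have "{\<omega> \<in> space M. W v \<omega> \<le> t} \<in> events"
    using weight_measurable[OF assms(1)] by measurable
  then have "prob {\<omega> \<in> space M. t < W v \<omega>} = 1 - prob {\<omega> \<in> space M. W v \<omega> \<le> t}"
    by (subst prob_compl[symmetric]) (auto intro!: arg_cong[where f = prob])
  then show ?thesis
    using weight_cdf[OF assms] by simp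
qed

text \<open>\<mu> is the expected number of vertices heavier than \<open>t\<close>. These form a
  clique, so the event fails only if their number is below a quarter of its mean.\<close>

lemma prob_clique_number_ge:
  assumes "1 \<le> n" "0 < lam" "0 < w0" "w0 \<le> t" "real n \<le> lam * t\<^sup>2"
  defines "\<mu> \<equiv> real n * (t / w0) powr (1 - \<beta>)"
  shows "1 - exp (- \<mu> / 4) \<le> prob {\<omega> \<in> space M. \<mu> / 4 \<le> real (clique_number {..<n}
      (girg_edges lam n d (\<lambda>v. W v \<omega>) (\<lambda>v. X v \<omega>)))}"
    (is "_ \<le> prob ?G")
proof -
  let ?Y = "\<lambda>v \<omega>. (W v \<omega>, X v \<omega>)"
  let ?P = "(\<Pi>\<^sub>M i\<in>{..<d}. lborel) :: (nat \<Rightarrow> real) measure"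
  \<comment> \<open>Independence over vertices is given for the pairs of weight and position, so the
    weight condition becomes a cylinder that leaves the position free.\<close>
  let ?A = "{t<..} \<times> space ?P"
  let ?few = "{\<omega> \<in> space M. real (card {v\<in>{..<n}. ?Y v \<omega> \<in> ?A}) \<le> \<mu> / 4}"
  have in_A: "?Y v \<omega> \<in> ?A \<longleftrightarrow> t < W v \<omega>" if "v < n" "\<omega> \<in> space M" for v \<omega>
    using measurable_space[OF position_measurable[OF that(1)] that(2)] by simp
  have "(\<Sum>v<n. prob {\<omega> \<in> space M. ?Y v \<omega> \<in> ?A}) = (\<Sum>v<n. (t / w0) powr (1 - \<beta>))"
  proof (rule sum.cong)
    fix v assume "v \<in> {..<n}"
    then have v: "v < n" by simp
    then have "{\<omega> \<in> space M. ?Y v \<omega> \<in> ?A} = {\<omega> \<in> space M. t < W v \<omega>}"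
      using in_A by blast
    then show "prob {\<omega> \<in> space M. ?Y v \<omega> \<in> ?A} = (t / w0) powr (1 - \<beta>)"
      using prob_weight_gt[OF v \<open>w0 \<le> t\<close>] by simp
  qed simp
  then have mean: "(\<Sum>v<n. prob {\<omega> \<in> space M. ?Y v \<omega> \<in> ?A}) = \<mu>"
    by (simp add: \<mu>_def)
  have few: "prob ?few \<le> exp (- \<mu> / 4)"
    using prob_count_le_quarter_mean[OF _ vertices_indep, of "\<lambda>_. ?A"] unfolding mean by auto
  have "\<omega> \<in> ?few" if "\<omega> \<in> space M - ?G" for \<omega>
  proof -
    let ?E = "girg_edges lam n d (\<lambda>v. W v \<omega>) (\<lambda>v. X v \<omega>)"
    have "clique {v\<in>{..<n}. t < W v \<omega>} ?E"
      using assms dim_pos by (intro clique_heavy_vertices) auto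
    then have "real (card {v\<in>{..<n}. t < W v \<omega>}) \<le> real (clique_number {..<n} ?E)"
      by (subst clique_number_ge_iff) auto
    also have "\<dots> < \<mu> / 4"
      using that by auto
    also have "{v\<in>{..<n}. t < W v \<omega>} = {v\<in>{..<n}. ?Y v \<omega> \<in> ?A}"
      using that in_A by blast
    finally show ?thesis
      using that by simp
  qed
  then have sub: "space M - ?G \<subseteq> ?few"
    by blast
  \<comment> \<open>Monotonicity of the measure requires the larger set to be an event; the count is
    measurable as a sum of indicators.\<close>
  have "?few \<in> events"
  proof -
    have "{\<omega> \<in> space M. ?Y v \<omega> \<in> ?A} \<in> events" if "v < n" for v
    proof -
      have "{\<omega> \<in> space M. ?Y v \<omega> \<in> ?A} = {\<omega> \<in> space M. t < W v \<omega>}"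
        using in_A that by blast
      then show ?thesis
        using weight_measurable[OF that] by simp
    qed
    then have meas: "(\<lambda>\<omega>. \<Sum>v<n. if ?Y v \<omega> \<in> ?A then 1 else 0 :: real) \<in> borel_measurable M"
      by (intro borel_measurable_sum measurable_If) auto
    have "(\<Sum>v<n. if ?Y v \<omega> \<in> ?A then 1 else 0 :: real)
        = real (card {v\<in>{..<n}. ?Y v \<omega> \<in> ?A})" for \<omega>
      by (simp add: sum.If_cases Int_def)
    from borel_measurable_le[OF meas[unfolded this] borel_measurable_const] show ?thesis .
  qed
  with sub have "prob (space M - ?G) \<le> prob ?few"
    by (rule finite_measure_mono)
  then show ?thesis
    using few prob_compl[OF clique_number_measurable, of "\<mu> / 4" lam] by linarith
qed

end

section \<open>Choice of constants and the limit\<close>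

theorem theorem18:
  fixes lam w0 \<beta> :: real
    and d :: "nat \<Rightarrow> nat"
    and M :: "nat \<Rightarrow> 'a measure"
    and W :: "nat \<Rightarrow> nat \<Rightarrow> 'a \<Rightarrow> real"
    and X :: "nat \<Rightarrow> nat \<Rightarrow> 'a \<Rightarrow> nat \<Rightarrow> real"
  assumes "0 < lam" and "0 < w0" and "2 < \<beta>" and "\<beta> < 3"
    and "\<And>n. 1 \<le> n \<Longrightarrow> girg (M n) n \<beta> w0 (d n) (W n) (X n)"
  shows "\<exists>c>0. (\<lambda>n. measure (M n) {\<omega> \<in> space (M n).
           c * real n powr ((3 - \<beta>) / 2) \<le>
           real (clique_number {..<n}
             (girg_edges lam n (d n) (\<lambda>v. W n v \<omega>) (\<lambda>v. X n v \<omega>)))}) \<longlonglongrightarrow> 1"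
proof -
  \<comment> \<open>With threshold \<open>B * sqrt (real n)\<close>, the bound
    \<open>w0 \<le> B\<close> keeps it in the range of the weight law, and
    \<open>1 / sqrt lam \<le> B\<close> yields \<open>real n \<le> lam * ?t\<^sup>2\<close>.\<close>
  define B where "B = max w0 (1 / sqrt lam)"
  define c where "c = (B / w0) powr (1 - \<beta>) / 4"
  have B: "w0 \<le> B" "1 / sqrt lam \<le> B" "0 < B"
    using assms by (auto simp: B_def)
  have "0 < c"
    using B assms by (simp add: c_def)
  have lower: "1 - exp (- (c * real n powr ((3 - \<beta>) / 2))) \<le> measure (M n) {\<omega> \<in> space (M n).
      c * real n powr ((3 - \<beta>) / 2) \<le> real (clique_number {..<n}
        (girg_edges lam n (d n) (\<lambda>v. W n v \<omega>) (\<lambda>v. X n v \<omega>)))}" if n: "1 \<le> n" for n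
  proof -
    interpret girg "M n" n \<beta> w0 "d n" "W n" "X n"
      using n by (rule assms)
    let ?t = "B * sqrt (real n)"
    have "B * 1 \<le> ?t"
      using B n by (intro mult_left_mono) auto
    then have t: "w0 \<le> ?t"
      using B(1) by linarith
    have "(1 / sqrt lam)\<^sup>2 \<le> B\<^sup>2"
      using B assms by (intro power_mono) auto
    then have "1 \<le> lam * B\<^sup>2"
      using assms by (simp add: field_simps)
    then have "1 * real n \<le> lam * B\<^sup>2 * real n"
      by (intro mult_right_mono) auto
    then have "real n \<le> lam * ?t\<^sup>2"
      by (simp add: power_mult_distrib)
    note main = prob_clique_number_ge[OF n \<open>0 < lam\<close> \<open>0 < w0\<close> t this]
    have "(?t / w0) powr (1 - \<beta>) = (B / w0 * sqrt (real n)) powr (1 - \<beta>)"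
      by simp
    also have "\<dots> = (B / w0) powr (1 - \<beta>) * real n powr ((1 - \<beta>) / 2)"
      using B assms by (subst powr_mult) (auto simp: powr_half_sqrt[symmetric] powr_powr)
    \<comment> \<open>Writing \<open>real n\<close> as a power lets the exponents add up: 1 + (1 -
      \<beta>)/2 = (3 - \<beta>)/2.\<close>
    finally have "real n * (?t / w0) powr (1 - \<beta>)
        = 4 * c * (real n powr 1 * real n powr ((1 - \<beta>) / 2))"
      using n by (simp add: c_def)
    also have "real n powr 1 * real n powr ((1 - \<beta>) / 2) = real n powr ((3 - \<beta>) / 2)"
      unfolding powr_add[symmetric] by (simp add: field_simps)
    finally have "real n * (?t / w0) powr (1 - \<beta>) / 4 = c * real n powr ((3 - \<beta>) / 2)"
      by simp
    then show ?thesis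
      using main by simp
  qed
  \<comment> \<open>Here \<beta> < 3 makes the exponent positive, so the failure bound tends to
    0.\<close>
  have "filterlim (\<lambda>n. real n powr ((3 - \<beta>) / 2)) at_top sequentially"
    using assms by (intro filterlim_compose[OF real_powr_at_top filterlim_real_sequentially]) simp
  then have "filterlim (\<lambda>n. c * real n powr ((3 - \<beta>) / 2)) at_top sequentially"
    using \<open>0 < c\<close> by (intro filterlim_tendsto_pos_mult_at_top[OF tendsto_const])
  then have "(\<lambda>n. exp (- (c * real n powr ((3 - \<beta>) / 2)))) \<longlonglongrightarrow> 0"
    by (intro filterlim_compose[OF exp_at_bot]) (simp add: filterlim_uminus_at_bot)
  then have lim: "(\<lambda>n. 1 - exp (- (c * real n powr ((3 - \<beta>) / 2)))) \<longlonglongrightarrow> 1"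
    using tendsto_diff[OF tendsto_const[of 1]] by fastforce
  have upper: "measure (M n) A \<le> 1" if "1 \<le> n" for n A
  proof -
    interpret girg "M n" n \<beta> w0 "d n" "W n" "X n"
      using that by (rule assms)
    show ?thesis by simp
  qed
  \<comment> \<open>Both bounds hold from \<open>n = 1\<close> on, where \<open>M n\<close> is known
    to be a probability space; this suffices for the limit.\<close>
  show ?thesis
    using \<open>0 < c\<close> lower upper
    by (intro exI[of _ c] conjI tendsto_sandwich[OF _ _ lim tendsto_const])
      (auto intro: eventually_sequentiallyI[of 1])
qed

end
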